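(* Let $p$ be a positive integer, let $b>0$, and let $X \in L^{p-1}$ be a real-valued random variable with $\mathbb{P}(X \in (-\infty,b])=1$. Then for all $s \geq 0$, $$\mathbb{E}\exp(sX) \leq \frac{\mathbb{E}\max(X^{p},0)}{b^{p}}\left(\exp(sb)-\sum_{j=0}^{p-1}\frac{s^{j}b^{j}}{j!}\right)+\mathbb{E}\left(\sum_{j=0}^{p-1}\frac{s^{j}X^{j}}{j!}\right) = \frac{\mathbb{E}\max(X^{p},0)}{b^{p}}\,T_{p+1}(sb)+\mathbb{E}\left(\sum_{j=0}^{p-1}\frac{s^{j}X^{j}}{j!}\right).$$
   Context: Random variables are defined on a fixed probability space $(\Omega,\mathcal{F},\mathbb{P})$ with expectation $\mathbb{E}$. $L^{q}$ denotes the space of random variables $X$ with $\mathbb{E}|X|^{q}<\infty$; for $q=0$ (the case $p=1$) the condition $X\in L^{0}$ is no restriction. For every positive integer $k$, $T_{k}(x):=\exp(x)-\sum_{j=0}^{k-2}\frac{x^{j}}{j!}$, with the convention that a sum $\sum_{j=0}^{m}$ with $m<0$ is $0$ (so $T_1(x)=\exp(x)$). Terms with $j=0$ use $s^{0}=X^{0}=1$. The expectation $\mathbb{E}\max(X^{p},0)$ is understood in $[0,\infty]$, with $\infty\cdot 0=0$. *)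

theory Defs
  imports "HOL-Probability.Probability"
begin

definition L_space :: "'a measure \<Rightarrow> nat \<Rightarrow> ('a \<Rightarrow> real) set" where
  "L_space M q = {X \<in> borel_measurable M. integrable M (\<lambda>\<omega>. \<bar>X \<omega>\<bar> ^ q)}"

text \<open>The sum has upper limit \<open>k - 2\<close> over the integers, so it is empty for \<open>k = 1\<close>. The range
  \<open>{..<k - 1}\<close> expresses this without truncated subtraction interfering (\<open>k\<close> is positive).\<close>

definition T :: "nat \<Rightarrow> real \<Rightarrow> real" where
  "T k x = exp x - (\<Sum>j<k - 1. x ^ j / fact j)"

text \<open>The Taylor sum in \<open>X\<close> is integrable for \<open>X\<close> in \<open>L\<^sup>p\<^sup>-\<^sup>1\<close>, so its Bochner integral is
  the genuine finite expectation and not the default value \<open>0\<close>.\<close>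

lemma (in prob_space) integrable_Taylor_sum:
  fixes X :: "'a \<Rightarrow> real" and p :: nat and s :: real
  assumes "X \<in> L_space M (p - 1)"
  shows "integrable M (\<lambda>\<omega>. \<Sum>j<p. s ^ j * X \<omega> ^ j / fact j)"
proof (rule Bochner_Integration.integrable_sum)
  fix j assume "j \<in> {..<p}"
  then have j: "j \<le> p - 1" by auto
  have X [measurable]: "X \<in> borel_measurable M"
    and int: "integrable M (\<lambda>\<omega>. \<bar>X \<omega>\<bar> ^ (p - 1))"
    using assms by (auto simp: L_space_def)
  have bound: "\<bar>x\<bar> ^ j \<le> 1 + \<bar>x\<bar> ^ (p - 1)" for x :: real
  proof (cases "\<bar>x\<bar> \<le> 1")
    case True
    then have "\<bar>x\<bar> ^ j \<le> 1" by (simp add: power_le_one)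
    then show ?thesis by (simp add: add_increasing2)
  next
    case False
    then have "\<bar>x\<bar> ^ j \<le> \<bar>x\<bar> ^ (p - 1)" using j by (intro power_increasing) auto
    then show ?thesis by simp
  qed
  have "integrable M (\<lambda>\<omega>. X \<omega> ^ j)"
  proof (rule Bochner_Integration.integrable_bound)
    show "integrable M (\<lambda>\<omega>. 1 + \<bar>X \<omega>\<bar> ^ (p - 1))" using int by simp
    show "AE \<omega> in M. norm (X \<omega> ^ j) \<le> norm (1 + \<bar>X \<omega>\<bar> ^ (p - 1))"
      using bound by (auto simp: power_abs intro!: AE_I2 order_trans[OF _ abs_ge_self])
  qed measurable
  then show "integrable M (\<lambda>\<omega>. s ^ j * X \<omega> ^ j / fact j)" by simp
qed

end

theory Submission
  imports Defs
begin

text \<open>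
  The bound is the expectation of a pointwise inequality. Write
  \<open>R y = exp y - (\<Sum>j<p. y ^ j / fact j)\<close> for the Taylor remainder of order \<open>p\<close>. For every
  \<open>x \<le> b\<close>,
  \<open>R (s * x) \<le> max (x ^ p) 0 / b ^ p * R (s * b)\<close>.
  For \<open>x \<ge> 0\<close> this says that \<open>R y / y ^ p\<close> increases on the positive half-line, which is visible
  from its power series: all coefficients are nonnegative (\<open>exp_remainder_ratio_mono\<close>). For
  \<open>x < 0\<close> the mean-value form of the remainder shows that \<open>R (s * x)\<close> is at most its leading term
  if \<open>p\<close> is even, and is nonpositive if \<open>p\<close> is odd (\<open>exp_remainder_neg_le\<close>); the leading term in turn
  is covered because \<open>R (s * b) \<ge> (s * b) ^ p / fact p\<close>.

  Adding the Taylor polynomial and integrating proves the theorem when the expectation of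
  \<open>max (X ^ p) 0\<close> is finite. It can be infinite (only for even \<open>p\<close>, through the negative
  values of \<open>X\<close>). Then the right-hand side is infinite if \<open>R (s * b) > 0\<close>, that is if \<open>s > 0\<close>;
  for \<open>s = 0\<close> the first term is \<open>\<infinity> * 0 = 0\<close> and both sides equal \<open>1\<close>.
\<close>

text \<open>This is \<open>T (p + 1)\<close>, indexed instead by the exponent of the first omitted term, which is
  the exponent that appears in every estimate below.\<close>

definition exp_remainder :: "nat \<Rightarrow> real \<Rightarrow> real" where
  "exp_remainder p y = exp y - (\<Sum>j<p. y ^ j / fact j)"

lemma exp_remainder_sums:
  "(\<lambda>n. y ^ (n + p) / fact (n + p)) sums exp_remainder p y"
proof -
  have "(\<lambda>n. y ^ n / fact n) sums exp y"
    using exp_converges[of y] by (simp add: divide_inverse mult.commute)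
  then show ?thesis
    unfolding exp_remainder_def by (rule sums_split_initial_segment)
qed

lemma exp_remainder_ge_leading_term:
  assumes "0 \<le> y"
  shows "y ^ p / fact p \<le> exp_remainder p y"
proof -
  have "(\<Sum>n<1. y ^ (n + p) / fact (n + p)) \<le> (\<Sum>n. y ^ (n + p) / fact (n + p))"
    using assms exp_remainder_sums[of y p] by (intro sum_le_suminf) (auto simp: sums_iff)
  then show ?thesis
    using exp_remainder_sums[of y p] by (simp add: sums_iff)
qed

text \<open>Monotonicity of \<open>R y / y ^ p\<close>, cleared of denominators so that \<open>y = 0\<close> is included.\<close>

lemma exp_remainder_ratio_mono:
  assumes "0 \<le> y" "y \<le> z"
  shows "exp_remainder p y * z ^ p \<le> y ^ p * exp_remainder p z"
proof (rule sums_le[OF _ sums_mult2[OF exp_remainder_sums] sums_mult[OF exp_remainder_sums]])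
  fix n
  have "y ^ n \<le> z ^ n"
    using assms by (intro power_mono)
  then have "y ^ n * (y ^ p * z ^ p) \<le> z ^ n * (y ^ p * z ^ p)"
    using assms by (intro mult_right_mono) auto
  then show "y ^ (n + p) / fact (n + p) * z ^ p \<le> y ^ p * (z ^ (n + p) / fact (n + p))"
    by (simp add: power_add divide_right_mono mult_ac)
qed

text \<open>For \<open>p > 0\<close> the remainder is \<open>exp t * y ^ p / fact p\<close> for some \<open>t\<close> with \<open>y < t < 0\<close>, so the
  exponential factor lies in the unit interval: it can be dropped when \<open>y ^ p\<close> is positive, and
  only the sign matters when \<open>y ^ p\<close> is negative.\<close>

lemma exp_remainder_neg_le:
  assumes "y < 0"
  shows "exp_remainder p y \<le> max (y ^ p) 0 / fact p"
proof (cases "p = 0")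
  case True
  then show ?thesis
    using assms by (simp add: exp_remainder_def)
next
  case False
  have "\<exists>t. y < t \<and> t < 0 \<and>
      exp y = (\<Sum>m<p. exp 0 / fact m * y ^ m) + exp t / fact p * y ^ p"
    using assms False by (intro Maclaurin_minus) auto
  then obtain t where t: "t < 0"
    and "exp y = (\<Sum>m<p. y ^ m / fact m) + exp t / fact p * y ^ p"
    by auto
  then have eq: "exp_remainder p y = exp t * y ^ p / fact p"
    by (simp add: exp_remainder_def)
  have "exp t * y ^ p \<le> exp t * max (y ^ p) 0"
    by (intro mult_left_mono) auto
  also have "\<dots> \<le> 1 * max (y ^ p) 0"
    using t by (intro mult_right_mono) auto
  finally show ?thesis
    by (simp add: eq divide_right_mono)
qed

text \<open>For negative \<open>y\<close> the leading term links the two sides: it dominates the remainder at \<open>y\<close>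
  and is dominated by the remainder at \<open>z\<close>. The maximum makes one formula serve both parities
  of \<open>p\<close>.\<close>

lemma exp_remainder_comparison:
  assumes "y \<le> z" "0 \<le> z"
  shows "exp_remainder p y * z ^ p \<le> max (y ^ p) 0 * exp_remainder p z"
proof (cases "0 \<le> y")
  case True
  then have "max (y ^ p) 0 = y ^ p"
    by (simp add: max_absorb1)
  then show ?thesis
    using exp_remainder_ratio_mono[OF True assms(1), of p] by simp
next
  case False
  then have "exp_remainder p y * z ^ p \<le> max (y ^ p) 0 / fact p * z ^ p"
    using exp_remainder_neg_le[of y p] assms by (intro mult_right_mono) auto
  also have "\<dots> = max (y ^ p) 0 * (z ^ p / fact p)"
    by simp
  also have "\<dots> \<le> max (y ^ p) 0 * exp_remainder p z"
    using exp_remainder_ge_leading_term[of z p] assms by (intro mult_left_mono) auto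
  finally show ?thesis .
qed

lemma Taylor_sum_zero:
  assumes "1 \<le> p"
  shows "(\<Sum>j<p. 0 ^ j * x ^ j / fact j :: real) = 1"
  using assms by (simp add: power_0_left if_distrib[of "\<lambda>c. c * _"]
      if_distrib[of "\<lambda>c. c / _"] sum.delta cong: if_cong)

lemma exp_le_remainder_plus_Taylor:
  assumes "x \<le> b" "0 < b" "0 \<le> s" "1 \<le> p"
  shows "exp (s * x) \<le> max (x ^ p) 0 / b ^ p * exp_remainder p (s * b)
           + (\<Sum>j<p. s ^ j * x ^ j / fact j)"
proof (cases "s = 0")
  case True
  then have "(\<Sum>j<p. s ^ j * x ^ j / fact j) = 1"
    using assms by (simp add: Taylor_sum_zero)
  moreover have "exp_remainder p (s * b) \<ge> 0"
    using exp_remainder_ge_leading_term[of "s * b" p] assms True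
    by (auto intro: order_trans[rotated])
  then have "max (x ^ p) 0 / b ^ p * exp_remainder p (s * b) \<ge> 0"
    using assms by (intro mult_nonneg_nonneg divide_nonneg_nonneg) auto
  ultimately show ?thesis
    using True by simp
next
  case False
  have s: "0 < s ^ p" and b: "0 < b ^ p"
    using False assms by auto
  have "exp_remainder p (s * x) * (s * b) ^ p
      \<le> max ((s * x) ^ p) 0 * exp_remainder p (s * b)"
    using assms by (intro exp_remainder_comparison mult_left_mono) auto
  also have "max ((s * x) ^ p) 0 = s ^ p * max (x ^ p) 0"
    using s max_mult_distrib_left[of "s ^ p" "x ^ p" 0] by (simp add: power_mult_distrib)
  finally have "s ^ p * (exp_remainder p (s * x) * b ^ p)
      \<le> s ^ p * (max (x ^ p) 0 * exp_remainder p (s * b))"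
    by (simp add: power_mult_distrib mult_ac)
  then have "exp_remainder p (s * x) * b ^ p \<le> max (x ^ p) 0 * exp_remainder p (s * b)"
    using s by (simp only: mult_le_cancel_left_pos)
  then have "exp_remainder p (s * x) \<le> max (x ^ p) 0 / b ^ p * exp_remainder p (s * b)"
    using b by (simp add: field_simps)
  then show ?thesis
    by (simp add: exp_remainder_def power_mult_distrib)
qed

theorem theorem1:
  fixes M :: "'a measure" and X :: "'a \<Rightarrow> real" and p :: nat and b s :: real
  assumes "prob_space M"
    and "p \<ge> 1"
    and "b > 0"
    and "X \<in> L_space M (p - 1)"
    and "measure M {\<omega> \<in> space M. X \<omega> \<in> {..b}} = 1"
    and "s \<ge> 0"
  shows
    "enn2ereal (\<integral>\<^sup>+ \<omega>. ennreal (exp (s * X \<omega>)) \<partial>M)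
       \<le> enn2ereal (\<integral>\<^sup>+ \<omega>. ennreal (max (X \<omega> ^ p) 0) \<partial>M) / ereal (b ^ p)
           * ereal (exp (s * b) - (\<Sum>j<p. s ^ j * b ^ j / fact j))
         + ereal (\<integral>\<omega>. (\<Sum>j<p. s ^ j * X \<omega> ^ j / fact j) \<partial>M)
     \<and> enn2ereal (\<integral>\<^sup>+ \<omega>. ennreal (max (X \<omega> ^ p) 0) \<partial>M) / ereal (b ^ p)
           * ereal (exp (s * b) - (\<Sum>j<p. s ^ j * b ^ j / fact j))
         + ereal (\<integral>\<omega>. (\<Sum>j<p. s ^ j * X \<omega> ^ j / fact j) \<partial>M)
       = enn2ereal (\<integral>\<^sup>+ \<omega>. ennreal (max (X \<omega> ^ p) 0) \<partial>M) / ereal (b ^ p)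
           * ereal (T (p + 1) (s * b))
         + ereal (\<integral>\<omega>. (\<Sum>j<p. s ^ j * X \<omega> ^ j / fact j) \<partial>M)"
proof -
  interpret prob_space M by fact
  have X [measurable]: "X \<in> borel_measurable M"
    using assms(4) by (simp add: L_space_def)
  define m where "m = (\<lambda>\<omega>. max (X \<omega> ^ p) 0)"
  define P where "P = (\<lambda>\<omega>. \<Sum>j<p. s ^ j * X \<omega> ^ j / fact j)"
  define R where "R = exp_remainder p (s * b)"
  have m [measurable]: "m \<in> borel_measurable M" and m_nonneg: "\<And>\<omega>. 0 \<le> m \<omega>"
    by (auto simp: m_def)
  have P: "integrable M P"
    unfolding P_def by (rule integrable_Taylor_sum) fact
  have R_eq: "exp (s * b) - (\<Sum>j<p. s ^ j * b ^ j / fact j) = R" "T (p + 1) (s * b) = R"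
    by (simp_all add: R_def exp_remainder_def T_def power_mult_distrib)
  have bp: "0 < b ^ p"
    using assms(3) by simp
  have "AE \<omega> in M. \<omega> \<in> {\<omega> \<in> space M. X \<omega> \<in> {..b}}"
    using assms(5) by (subst AE_in_set_eq_1) auto
  then have pointwise: "AE \<omega> in M. exp (s * X \<omega>) \<le> m \<omega> / b ^ p * R + P \<omega>"
  proof eventually_elim
    case (elim \<omega>)
    then show ?case
      unfolding m_def P_def R_def using assms by (intro exp_le_remainder_plus_Taylor) auto
  qed
  have "enn2ereal (\<integral>\<^sup>+ \<omega>. ennreal (exp (s * X \<omega>)) \<partial>M)
      \<le> enn2ereal (\<integral>\<^sup>+ \<omega>. ennreal (m \<omega>) \<partial>M) / ereal (b ^ p) * ereal R + ereal (\<integral>\<omega>. P \<omega> \<partial>M)"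
  proof (cases "(\<integral>\<^sup>+ \<omega>. ennreal (m \<omega>) \<partial>M) < \<infinity>")
    case True
    then have int_m: "integrable M m"
      using m_nonneg by (intro integrableI_nonneg) auto
    let ?G = "\<lambda>\<omega>. m \<omega> / b ^ p * R + P \<omega>"
    have int_G: "integrable M ?G"
      using int_m P by simp
    have G_nonneg: "AE \<omega> in M. 0 \<le> ?G \<omega>"
      using pointwise by eventually_elim (meson exp_ge_zero order_trans)
    have "(\<integral>\<^sup>+ \<omega>. ennreal (exp (s * X \<omega>)) \<partial>M) \<le> (\<integral>\<^sup>+ \<omega>. ennreal (?G \<omega>) \<partial>M)"
      using pointwise by (intro nn_integral_mono_AE) (auto intro: ennreal_leI)
    also have "\<dots> = ennreal (\<integral>\<omega>. ?G \<omega> \<partial>M)"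
      by (rule nn_integral_eq_integral[OF int_G G_nonneg])
    finally have "enn2ereal (\<integral>\<^sup>+ \<omega>. ennreal (exp (s * X \<omega>)) \<partial>M) \<le> ereal (\<integral>\<omega>. ?G \<omega> \<partial>M)"
      using integral_nonneg_AE[OF G_nonneg] by (simp add: less_eq_ennreal.rep_eq enn2ereal_ennreal)
    also have "(\<integral>\<omega>. ?G \<omega> \<partial>M) = (\<integral>\<omega>. m \<omega> \<partial>M) / b ^ p * R + (\<integral>\<omega>. P \<omega> \<partial>M)"
      using int_m P by simp
    also have "ereal \<dots> = enn2ereal (\<integral>\<^sup>+ \<omega>. ennreal (m \<omega>) \<partial>M) / ereal (b ^ p) * ereal R
        + ereal (\<integral>\<omega>. P \<omega> \<partial>M)"
      using int_m m_nonneg assms(3)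
      by (simp add: nn_integral_eq_integral enn2ereal_ennreal integral_nonneg)
    finally show ?thesis .
  next
    case False
    then have inf: "enn2ereal (\<integral>\<^sup>+ \<omega>. ennreal (m \<omega>) \<partial>M) / ereal (b ^ p) = \<infinity>"
      using bp by (simp add: less_top[symmetric])
    show ?thesis
    proof (cases "s = 0")
      case True
      have "R = 0"
        using R_eq(1) Taylor_sum_zero[OF assms(2), of b] True by simp
      moreover have "P = (\<lambda>_. 1)"
        using Taylor_sum_zero[OF assms(2)] True by (simp add: P_def)
      ultimately show ?thesis
        using True by (simp add: emeasure_space_1 prob_space one_ennreal.rep_eq flip: zero_ereal_def one_ereal_def)
    next
      case False
      then have "0 < (s * b) ^ p / fact p"
        using assms by simp
      also have "\<dots> \<le> R"
        unfolding R_def using assms by (intro exp_remainder_ge_leading_term) auto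
      finally show ?thesis
        unfolding inf by simp
    qed
  qed
  then show ?thesis
    unfolding R_eq m_def P_def by simp
qed

end
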